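(* Let $\mathcal H$ be a real separable infinite-dimensional Hilbert space and let $\nu$ be a reference probability measure on $\mathcal H$, i.e. a symmetric Borel probability measure with $\operatorname{supp}(\nu)=\mathcal H$. Then the set $\mathcal P(\mathcal H)$ of all Borel probability measures on $\mathcal H$, equipped with $\operatorname{Ed}_\nu$, is a metric space.
   Context: $\langle\cdot,\cdot\rangle$ is the inner product of $\mathcal H$. A Borel probability measure $\nu$ on $\mathcal H$ is symmetric if $\nu(B)=\nu(-B)$ for every Borel set $B$, where $-B=\{w\in\mathcal H:-w\in B\}$. The characteristic functional of $\mathbb P\in\mathcal P(\mathcal H)$ is $\varphi_{\mathbb P}(w)=\int_{\mathcal H}\exp(\mathrm i\langle w,z\rangle)\,\mathbb P(\mathrm dz)$. The energy distance is the nonnegative square root $\operatorname{Ed}_\nu(\mathbb P,\mathbb Q)$ of $\operatorname{Ed}_\nu^2(\mathbb P,\mathbb Q)=\int_{\mathcal H}|\varphi_{\mathbb P}(w)-\varphi_{\mathbb Q}(w)|^2\,\nu(\mathrm dw)$. *)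

theory Defs
  imports "HOL-Probability.Probability"
begin

definition char_functional :: "'a::real_inner measure \<Rightarrow> 'a \<Rightarrow> complex" where
  "char_functional P w = (CLINT z|P. exp (\<i> * complex_of_real (w \<bullet> z)))"

definition measure_support :: "'a::topological_space measure \<Rightarrow> 'a set" where
  "measure_support M = {x. \<forall>U. open U \<and> x \<in> U \<longrightarrow> emeasure M U > 0}"

definition symmetric_measure :: "'a::real_normed_vector measure \<Rightarrow> bool" where
  "symmetric_measure M \<longleftrightarrow> (\<forall>B\<in>sets borel. emeasure M B = emeasure M {w. - w \<in> B})"

definition borel_prob_measures :: "'a::topological_space measure set" where
  "borel_prob_measures = {P. sets P = sets borel \<and> prob_space P}"

definition reference_measure :: "'a::real_normed_vector measure \<Rightarrow> bool" where
  "reference_measure M \<longleftrightarrow>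
     M \<in> borel_prob_measures \<and> symmetric_measure M \<and> measure_support M = UNIV"

(* For Borel probability measures the integrand is continuous and bounded by 4, so the
   Bochner integral is the genuine one and never the default value 0. *)
definition energy_dist :: "'a::real_inner measure \<Rightarrow> 'a measure \<Rightarrow> 'a measure \<Rightarrow> real" where
  "energy_dist M P Q =
     sqrt (LINT w|M. (cmod (char_functional P w - char_functional Q w))\<^sup>2)"

end

theory Submission
  imports Defs
begin

text \<open>
  The number \<open>energy_dist \<nu> P Q\<close> is the distance of the two characteristic functionals in
  \<open>L\<^sup>2(\<nu>)\<close>. These functionals are bounded by \<open>1\<close>, so the distance is finite, and the triangle
  inequality is Minkowski's inequality (\<open>sqrt_integral_power2_triangle\<close>). What remains is that
  distance \<open>0\<close> forces \<open>P = Q\<close>. Characteristic functionals are continuous, so if two of them agree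
  \<open>\<nu>\<close>-almost everywhere, then the set where they differ is open and \<open>\<nu>\<close>-null, hence empty because
  \<open>\<nu>\<close> has full support (\<open>continuous_AE_zero_imp_zero\<close>). It remains to see that a Borel probability
  measure on a separable inner product space is determined by its characteristic functional
  (\<open>char_functional_determines_measure\<close>).

  This is reduced to Levy's uniqueness theorem on the real line, bypassing
  finite-dimensional Fourier inversion. Consider the sets \<open>A\<close> on which \<open>P\<close> and \<open>Q\<close> have the same
  Fourier transform, meaning that the restrictions of \<open>P\<close> and \<open>Q\<close> to \<open>A\<close> have equal
  characteristic functionals. The whole space is such a set by hypothesis. If \<open>A\<close> is one, so is
  its intersection with any slice \<open>{z. u \<bullet> z \<in> B}\<close> (\<open>fourier_on_slice\<close>). Hence all finite
  intersections of half-spaces are such sets, and evaluating the Fourier transform at \<open>0\<close> shows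
  that they have the same measure under \<open>P\<close> and \<open>Q\<close>. By separability the half-spaces generate
  the Borel sets (\<open>open_in_sigma_halfspaces\<close>), so \<open>P = Q\<close>.
\<close>

section \<open>Minkowski's inequality for square-integrable functions\<close>

text \<open>
  Instead of the Cauchy--Schwarz inequality, the proof integrates the pointwise bound
  \<open>(f + g)\<^sup>2 \<le> (1 + b/a) f\<^sup>2 + (1 + a/b) g\<^sup>2\<close>, which holds for all \<open>a, b > 0\<close>.
  When \<open>a\<close> and \<open>b\<close> are the two norms, the right-hand side integrates to \<open>(a + b)\<^sup>2\<close>.
\<close>

lemma sqrt_integral_power2_triangle:
  fixes f g h :: "'a \<Rightarrow> real"
  assumes f: "integrable M (\<lambda>x. (f x)\<^sup>2)" and g: "integrable M (\<lambda>x. (g x)\<^sup>2)"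
    and h: "integrable M (\<lambda>x. (h x)\<^sup>2)"
    and le: "\<And>x. \<bar>h x\<bar> \<le> \<bar>f x\<bar> + \<bar>g x\<bar>"
  shows "sqrt (LINT x|M. (h x)\<^sup>2) \<le> sqrt (LINT x|M. (f x)\<^sup>2) + sqrt (LINT x|M. (g x)\<^sup>2)"
proof (rule field_le_epsilon)
  fix e :: real assume e: "e > 0"
  \<comment> \<open>The norms may vanish; adding half of the slack \<open>e\<close> to each makes the quotients below meaningful.\<close>
  define a where "a = sqrt (LINT x|M. (f x)\<^sup>2) + e / 2"
  define b where "b = sqrt (LINT x|M. (g x)\<^sup>2) + e / 2"
  have pos: "a > 0" "b > 0"
    using e by (auto simp: a_def b_def intro!: add_nonneg_pos)
  have a2: "(LINT x|M. (f x)\<^sup>2) \<le> a\<^sup>2"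
    unfolding a_def using e by (intro sqrt_le_D) simp
  have b2: "(LINT x|M. (g x)\<^sup>2) \<le> b\<^sup>2"
    unfolding b_def using e by (intro sqrt_le_D) simp
  have pointwise: "(h x)\<^sup>2 \<le> (1 + b / a) * (f x)\<^sup>2 + (1 + a / b) * (g x)\<^sup>2" for x
  proof -
    have "(h x)\<^sup>2 \<le> (\<bar>f x\<bar> + \<bar>g x\<bar>)\<^sup>2"
      using le[of x] by (metis abs_ge_zero power2_abs power_mono)
    moreover have "(1 + b / a) * (f x)\<^sup>2 + (1 + a / b) * (g x)\<^sup>2 - (\<bar>f x\<bar> + \<bar>g x\<bar>)\<^sup>2
        = (b * \<bar>f x\<bar> - a * \<bar>g x\<bar>)\<^sup>2 / (a * b)"
      using pos by (simp add: field_simps power2_eq_square)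
    moreover have "(b * \<bar>f x\<bar> - a * \<bar>g x\<bar>)\<^sup>2 / (a * b) \<ge> 0"
      using pos by simp
    ultimately show ?thesis by linarith
  qed
  have "(LINT x|M. (h x)\<^sup>2) \<le> (LINT x|M. (1 + b / a) * (f x)\<^sup>2 + (1 + a / b) * (g x)\<^sup>2)"
    by (intro integral_mono pointwise h f g Bochner_Integration.integrable_add integrable_mult_right)
  also have "\<dots> = (1 + b / a) * (LINT x|M. (f x)\<^sup>2) + (1 + a / b) * (LINT x|M. (g x)\<^sup>2)"
    using f g by simp
  also have "\<dots> \<le> (1 + b / a) * a\<^sup>2 + (1 + a / b) * b\<^sup>2"
    using pos by (intro add_mono mult_left_mono a2 b2) auto
  also have "\<dots> = (a + b)\<^sup>2"
    using pos by (simp add: field_simps power2_eq_square)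
  finally have "sqrt (LINT x|M. (h x)\<^sup>2) \<le> a + b"
    using pos by (intro real_le_lsqrt) auto
  then show "sqrt (LINT x|M. (h x)\<^sup>2)
      \<le> sqrt (LINT x|M. (f x)\<^sup>2) + sqrt (LINT x|M. (g x)\<^sup>2) + e"
    by (simp add: a_def b_def)
qed

section \<open>Levy's uniqueness theorem for weighted laws\<close>

text \<open>
  Levy's theorem concerns probability measures. Two finite measures with the same characteristic
  function have the same total mass \<open>m\<close>, its value at \<open>0\<close>, so both can be divided by \<open>m\<close> unless
  they are null.
\<close>

lemma Levy_uniqueness_finite:
  fixes M N :: "real measure"
  assumes "finite_measure M" "finite_measure N"
    and sets: "sets M = sets borel" "sets N = sets borel"
    and char: "char M = char N"
  shows "M = N"
proof -
  interpret M: finite_measure M by fact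
  interpret N: finite_measure N by fact
  have space: "space M = UNIV" "space N = UNIV"
    using sets[THEN sets_eq_imp_space_eq] by auto
  define m where "m = measure M UNIV"
  have "char M 0 = measure M UNIV" "char N 0 = measure N UNIV"
    by (simp_all add: char_def space scaleR_conv_of_real)
  with char have m': "m = measure N UNIV"
    by (simp add: m_def)
  show ?thesis
  proof (cases "m = 0")
    case True
    have "emeasure M B = 0" "emeasure N B = 0" if "B \<in> sets borel" for B
      using True M.bounded_measure[of B] N.bounded_measure[of B]
      by (simp_all add: M.emeasure_eq_measure N.emeasure_eq_measure space
          m_def[symmetric] m'[symmetric] measure_le_0_iff)
    then show ?thesis
      by (intro measure_eqI) (simp_all add: sets)
  next
    case False
    then have m: "m > 0" by (simp add: m_def zero_less_measure_iff)
    have normal: "real_distribution (density L (\<lambda>_. ennreal (1 / m)))"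
      if L: "finite_measure L" "sets L = sets borel" "measure L UNIV = m" for L :: "real measure"
    proof -
      interpret L: finite_measure L by fact
      have "space L = UNIV" using L(2)[THEN sets_eq_imp_space_eq] by simp
      moreover have "ennreal (1 / m) * ennreal m = 1"
        using m by (simp flip: ennreal_mult'')
      ultimately have "prob_space (density L (\<lambda>_. ennreal (1 / m)))"
        using L by (intro prob_spaceI) (simp add: emeasure_density L.emeasure_eq_measure
            nn_integral_cmult_indicator)
      then show ?thesis
        using L(2) by (simp add: real_distribution_def real_distribution_axioms_def)
    qed
    have scaled: "char (density L (\<lambda>_. ennreal (1 / m))) t = char L t /\<^sub>R m"
      if L: "sets L = sets borel" for L :: "real measure" and t
    proof -
      have "(\<lambda>x. iexp (t * x)) \<in> borel_measurable L"
        unfolding measurable_cong_sets[OF L refl] by measurable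
      then show ?thesis
        unfolding char_def using m by (subst integral_density) (simp_all add: divide_inverse)
    qed
    have "char (density M (\<lambda>_. ennreal (1 / m))) = char (density N (\<lambda>_. ennreal (1 / m)))"
      using char by (simp add: fun_eq_iff scaled sets)
    then have eq: "density M (\<lambda>_. ennreal (1 / m)) = density N (\<lambda>_. ennreal (1 / m))"
      using assms m' by (intro Levy_uniqueness normal) (simp_all add: m_def)
    show ?thesis
    proof (rule measure_eqI)
      fix B assume "B \<in> sets M"
      then have "B \<in> sets M" "B \<in> sets N" using sets by auto
      then have "ennreal (1 / m) * emeasure M B = ennreal (1 / m) * emeasure N B"
        using arg_cong[OF eq, of "\<lambda>L. emeasure L B"]
        by (simp add: emeasure_density nn_integral_cmult_indicator)
      then show "emeasure M B = emeasure N B"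
        using m by (simp add: ennreal_mult_cancel_left)
    qed (simp add: sets)
  qed
qed

text \<open>
  Both integrals over \<open>g\<close> times a function of \<open>f\<close> are integrals against the image under \<open>f\<close> of
  the measure with density \<open>g\<close>; the hypothesis says that these two finite measures on the line have
  the same characteristic function.
\<close>

lemma weighted_law_eq_if_weighted_fourier_eq:
  fixes f :: "'a \<Rightarrow> real" and g :: "'a \<Rightarrow> real"
  assumes meas [measurable]: "f \<in> borel_measurable P" "f \<in> borel_measurable Q"
    and g: "integrable P g" "integrable Q g" "\<And>x. g x \<ge> 0"
    and B: "B \<in> sets borel"
    and eq: "\<And>s. (CLINT x|P. g x *\<^sub>R iexp (s * f x)) = (CLINT x|Q. g x *\<^sub>R iexp (s * f x))"
  shows "(LINT x|P. g x * indicat_real B (f x)) = (LINT x|Q. g x * indicat_real B (f x))"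
proof -
  define L where "L N = distr (density N (\<lambda>x. ennreal (g x))) borel f" for N :: "'a measure"
  have [measurable]: "g \<in> borel_measurable P" "g \<in> borel_measurable Q"
    using g by auto
  have fin: "finite_measure (L N)" if "integrable N g" "f \<in> borel_measurable N" for N
  proof -
    have [measurable]: "g \<in> borel_measurable N" "f \<in> borel_measurable N" using that by auto
    have "(\<integral>\<^sup>+x. ennreal (g x) \<partial>N) < \<infinity>"
      using that(1) g(3) by (simp add: nn_integral_eq_integral)
    moreover have "emeasure (L N) (space (L N)) = (\<integral>\<^sup>+x. ennreal (g x) \<partial>N)"
      by (simp add: L_def emeasure_distr emeasure_density cong: nn_integral_cong)
    ultimately show ?thesis by (intro finite_measureI) simp
  qed
  have "char (L P) = char (L Q)"
    using eq g(3) by (auto simp: char_def L_def integral_distr integral_density)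
  then have LPQ: "L P = L Q"
    using g by (intro Levy_uniqueness_finite fin) (simp_all add: L_def)
  have "(LINT y|L N. indicat_real B y) = (LINT x|N. g x * indicat_real B (f x))"
    if [measurable]: "g \<in> borel_measurable N" "f \<in> borel_measurable N" for N
    unfolding L_def using g(3) B by (subst integral_distr) (simp_all add: integral_density)
  from this[of P] this[of Q] show ?thesis by (simp add: LPQ)
qed

section \<open>Characteristic functionals determine measures\<close>

lemma borel_prob_measuresD:
  assumes "P \<in> borel_prob_measures"
  shows "prob_space P" "sets P = sets borel" "space P = UNIV"
  using assms sets_eq_imp_space_eq[of P borel] by (auto simp: borel_prob_measures_def)

lemma measurable_borel_prob_measures:
  assumes "P \<in> borel_prob_measures" "f \<in> borel_measurable borel"
  shows "f \<in> borel_measurable P"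
  using assms measurable_cong_sets[of P borel borel borel] borel_prob_measuresD(2)[OF assms(1)] by blast

lemma integrable_borel_prob_measures:
  fixes f :: "'a::topological_space \<Rightarrow> 'b::{banach, second_countable_topology}"
  assumes P: "P \<in> borel_prob_measures" and f: "f \<in> borel_measurable borel"
    and le: "\<And>x. norm (f x) \<le> C"
  shows "integrable P f"
proof -
  interpret prob_space P using P by (rule borel_prob_measuresD)
  show ?thesis
    using measurable_borel_prob_measures[OF P f] le by (intro integrable_const_bound[of _ C]) auto
qed

definition fourier_on ::
    "'a::real_inner measure \<Rightarrow> 'a set \<Rightarrow> 'a \<Rightarrow> complex" where
  "fourier_on P A w = (CLINT z|P. indicat_real A z *\<^sub>R iexp (w \<bullet> z))"

lemma integrable_fourier_on:
  fixes P :: "'a::{real_inner, second_countable_topology} measure"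
  assumes "P \<in> borel_prob_measures" "A \<in> sets borel"
  shows "integrable P (\<lambda>z. indicat_real A z *\<^sub>R iexp (w \<bullet> z))"
  using assms by (intro integrable_borel_prob_measures[where C=1]) (auto simp: indicator_def)

text \<open>
  The weight \<open>1 + Re (c * iexp (w \<bullet> z))\<close> carries the frequency \<open>w\<close> but is real, and nonnegative when
  \<open>cmod c \<le> 1\<close>, so that it can serve as a density. Its Fourier transform in direction \<open>u\<close> involves
  only values of \<open>fourier_on P A\<close>, since the real part is half the sum of a character and
  its conjugate.
\<close>

lemma fourier_on_tilted:
  fixes P :: "'a::{real_inner, second_countable_topology} measure"
  assumes P: "P \<in> borel_prob_measures" and A: "A \<in> sets borel"
  shows "(CLINT z|P. (indicat_real A z * (1 + Re (c * iexp (w \<bullet> z)))) *\<^sub>R iexp (s * (u \<bullet> z)))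
    = fourier_on P A (s *\<^sub>R u) + c / 2 * fourier_on P A (w + s *\<^sub>R u)
      + cnj c / 2 * fourier_on P A (s *\<^sub>R u - w)"
proof -
  have pointwise: "(indicat_real A z * (1 + Re (c * iexp (w \<bullet> z)))) *\<^sub>R iexp (s * (u \<bullet> z))
    = indicat_real A z *\<^sub>R iexp ((s *\<^sub>R u) \<bullet> z)
      + c / 2 * (indicat_real A z *\<^sub>R iexp ((w + s *\<^sub>R u) \<bullet> z))
      + cnj c / 2 * (indicat_real A z *\<^sub>R iexp ((s *\<^sub>R u - w) \<bullet> z))" for z
  proof -
    have "complex_of_real (Re (c * iexp (w \<bullet> z)))
        = (c * iexp (w \<bullet> z) + cnj (c * iexp (w \<bullet> z))) / 2"
      by (subst complex_add_cnj) simp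
    also have "\<dots> = c / 2 * iexp (w \<bullet> z) + cnj c / 2 * iexp (- (w \<bullet> z))"
      by (simp add: exp_cnj add_divide_distrib)
    finally have Re: "complex_of_real (Re (c * iexp (w \<bullet> z)))
        = c / 2 * iexp (w \<bullet> z) + cnj c / 2 * iexp (- (w \<bullet> z))" .
    have add: "iexp ((w + s *\<^sub>R u) \<bullet> z) = iexp (w \<bullet> z) * iexp (s * (u \<bullet> z))"
      "iexp ((s *\<^sub>R u - w) \<bullet> z) = iexp (- (w \<bullet> z)) * iexp (s * (u \<bullet> z))"
      by (simp_all add: inner_simps algebra_simps flip: exp_add)
    show ?thesis
      unfolding scaleR_conv_of_real of_real_mult of_real_add Re add
      by (simp add: algebra_simps)
  qed
  note int = integrable_fourier_on[OF P A]
  show ?thesis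
    unfolding pointwise fourier_on_def
    by (simp only: Bochner_Integration.integral_add[OF Bochner_Integration.integrable_add
          [OF int integrable_mult_right[OF int]] integrable_mult_right[OF int]]
        Bochner_Integration.integral_add[OF int integrable_mult_right[OF int]]
        integral_mult_right_zero)
qed

text \<open>
  Fix a frequency \<open>w\<close>. For \<open>cmod c \<le> 1\<close>, the nonnegative weight \<open>1 + Re (c * iexp (w \<bullet> z))\<close> on \<open>A\<close>
  gives the variable \<open>u \<bullet> z\<close> the same law under \<open>P\<close> and \<open>Q\<close>, by \<open>fourier_on_tilted\<close> and Levy's
  theorem. Thus its integrals over the slice agree. Subtracting the case \<open>c = 0\<close> leaves the integral
  of \<open>Re (c * iexp (w \<bullet> z))\<close>, and \<open>c = 1\<close> and \<open>c = - \<i>\<close> yield the real and the imaginary part of the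
  Fourier transform over the slice.
\<close>

lemma fourier_on_slice:
  fixes P Q :: "'a::{real_inner, second_countable_topology} measure"
  assumes P: "P \<in> borel_prob_measures" and Q: "Q \<in> borel_prob_measures"
    and A [measurable]: "A \<in> sets borel" and B [measurable]: "B \<in> sets borel"
    and eq: "fourier_on P A = fourier_on Q A"
  shows "fourier_on P (A \<inter> {z. u \<bullet> z \<in> B}) = fourier_on Q (A \<inter> {z. u \<bullet> z \<in> B})"
proof
  fix w :: 'a
  let ?S = "A \<inter> {z. u \<bullet> z \<in> B}"
  have S [measurable]: "?S \<in> sets borel" by measurable
  define e where "e c z = Re (c * iexp (w \<bullet> z))" for c and z :: 'a
  have e_le: "\<bar>e c z\<bar> \<le> 1" if "cmod c \<le> 1" for c z
    using that abs_Re_le_cmod[of "c * iexp (w \<bullet> z)"] by (simp add: e_def norm_mult)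
  have [measurable]: "e c \<in> borel_measurable borel" for c
    unfolding e_def by measurable
  have int: "integrable N (\<lambda>z. indicat_real T z * (1 + e c z))"
    if "N \<in> borel_prob_measures" "cmod c \<le> 1" "T \<in> sets borel" for N c T
  proof (rule integrable_borel_prob_measures[OF that(1), where C=2])
    show "norm (indicat_real T z * (1 + e c z)) \<le> 2" for z
      using e_le[OF that(2), of z] by (simp add: indicator_def abs_le_iff)
  qed (use that(3) in measurable)
  have tilted: "(LINT z|P. indicat_real ?S z * (1 + e c z)) = (LINT z|Q. indicat_real ?S z * (1 + e c z))"
    if c: "cmod c \<le> 1" for c
  proof -
    have "(LINT z|P. indicat_real A z * (1 + e c z) * indicat_real B (u \<bullet> z))
        = (LINT z|Q. indicat_real A z * (1 + e c z) * indicat_real B (u \<bullet> z))"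
    proof (rule weighted_law_eq_if_weighted_fourier_eq)
      show "indicat_real A z * (1 + e c z) \<ge> 0" for z
        using e_le[OF c, of z] by (simp add: indicator_def)
      show "(CLINT z|P. (indicat_real A z * (1 + e c z)) *\<^sub>R iexp (s * (u \<bullet> z)))
          = (CLINT z|Q. (indicat_real A z * (1 + e c z)) *\<^sub>R iexp (s * (u \<bullet> z)))" for s
        unfolding e_def by (simp only: fourier_on_tilted[OF P A] fourier_on_tilted[OF Q A] eq)
      show "(\<lambda>z. u \<bullet> z) \<in> borel_measurable P" "(\<lambda>z. u \<bullet> z) \<in> borel_measurable Q"
        by (simp_all add: measurable_borel_prob_measures P Q)
    qed (fact int[OF P c A] int[OF Q c A] B)+
    moreover have "indicat_real A z * (1 + e c z) * indicat_real B (u \<bullet> z)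
        = indicat_real ?S z * (1 + e c z)" for z
      by (simp add: indicator_def)
    ultimately show ?thesis by simp
  qed
  have Re_eq: "(LINT z|N. indicat_real ?S z * e c z) = Re (c * fourier_on N ?S w)"
    if "N \<in> borel_prob_measures" for N c
  proof -
    have "c * fourier_on N ?S w = (CLINT z|N. c * (indicat_real ?S z *\<^sub>R iexp (w \<bullet> z)))"
      by (simp only: fourier_on_def integral_mult_right_zero)
    also have "Re \<dots> = (LINT z|N. Re (c * (indicat_real ?S z *\<^sub>R iexp (w \<bullet> z))))"
      by (intro integral_Re[symmetric] integrable_mult_right integrable_fourier_on that S)
    also have "\<dots> = (LINT z|N. indicat_real ?S z * e c z)"
      by (simp add: e_def)
    finally show ?thesis ..
  qed
  have diff: "(LINT z|N. indicat_real ?S z * e c z)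
      = (LINT z|N. indicat_real ?S z * (1 + e c z)) - (LINT z|N. indicat_real ?S z * (1 + e 0 z))"
    if "N \<in> borel_prob_measures" "cmod c \<le> 1" for N c
    using int[OF that S] int[OF that(1) _ S, of 0]
    by (subst Bochner_Integration.integral_diff[symmetric]) (simp_all add: algebra_simps e_def)
  have "Re (c * fourier_on P ?S w) = Re (c * fourier_on Q ?S w)" if "cmod c \<le> 1" for c
    unfolding Re_eq[OF P, symmetric] Re_eq[OF Q, symmetric]
    using diff[OF P that] diff[OF Q that] tilted[OF that] tilted[of 0] by simp
  from this[of 1] this[of "- \<i>"]
  show "fourier_on P ?S w = fourier_on Q ?S w"
    by (simp add: complex_eq_iff)
qed

text \<open>
  The norm is a supremum of continuous linear functionals, so a closed ball of positive radius is an
  intersection of half-spaces. The half-space whose normal \<open>d\<close> points from the centre to an outside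
  point excludes that point strictly, hence so do those with nearby normals. Therefore normals from
  a countable dense set suffice, and every open set is a countable union of closed balls.
\<close>

lemma open_in_sigma_halfspaces:
  fixes U :: "'a::{real_inner, second_countable_topology} set"
  assumes U: "open U"
    and half: "\<And>u b. {z. u \<bullet> z \<le> b} \<in> \<H>"
  shows "U \<in> sigma_sets UNIV \<H>"
proof -
  obtain D :: "'a set" where D: "countable D" "\<And>X. open X \<Longrightarrow> X \<noteq> {} \<Longrightarrow> \<exists>d\<in>D. d \<in> X"
    using countable_dense_exists by blast
  have cball: "cball x r \<in> sigma_sets UNIV \<H>" if r: "r > 0" for x r
  proof -
    have "z \<in> cball x r" if z: "\<And>d. d \<in> D \<Longrightarrow> d \<bullet> z \<le> r * norm d + d \<bullet> x" for z
    proof (rule ccontr)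
      let ?X = "{d. r * norm d < d \<bullet> (z - x)}"
      assume "z \<notin> cball x r"
      then have "r < norm (z - x)" by (simp add: dist_norm norm_minus_commute)
      then have "r * norm (z - x) < norm (z - x) * norm (z - x)"
        using r by (intro mult_strict_right_mono) auto
      then have "z - x \<in> ?X"
        by (simp add: dot_square_norm power2_eq_square)
      moreover have "open ?X"
        by (intro open_Collect_less continuous_intros)
      ultimately obtain d where "d \<in> D" "d \<in> ?X" using D(2)[of ?X] by blast
      with z[of d] show False by (simp add: inner_diff_right)
    qed
    moreover have "d \<bullet> z \<le> r * norm d + d \<bullet> x" if "z \<in> cball x r" for z d
    proof -
      have "d \<bullet> (z - x) \<le> norm d * norm (z - x)" by (rule norm_cauchy_schwarz)
      also have "\<dots> \<le> norm d * r"
        using that by (intro mult_left_mono) (simp_all add: dist_norm norm_minus_commute)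
      finally show ?thesis by (simp add: inner_diff_right mult.commute)
    qed
    ultimately have "cball x r = (\<Inter>d\<in>D. {z. d \<bullet> z \<le> r * norm d + d \<bullet> x})"
      by blast
    moreover have "D \<noteq> {}" using D(2)[of UNIV] by auto
    ultimately show ?thesis
      using D(1) half by (auto intro!: sigma_algebra.countable_INT' sigma_algebra_sigma_sets)
  qed
  let ?I = "{(d, q). d \<in> D \<and> q \<in> \<rat> \<and> q > 0 \<and> cball d q \<subseteq> U}"
  have "\<exists>i\<in>?I. x \<in> cball (fst i) (snd i)" if x: "x \<in> U" for x
  proof -
    obtain e where e: "e > 0" "ball x e \<subseteq> U" using U x openE by blast
    obtain q where q: "q \<in> \<rat>" "0 < q" "q < e / 2"
      using Rats_dense_in_real[of 0 "e / 2"] e by auto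
    obtain d where d: "d \<in> D" "d \<in> ball x q" using D(2)[of "ball x q"] q by auto
    have "cball d q \<subseteq> ball x e"
    proof
      fix y assume "y \<in> cball d q"
      then show "y \<in> ball x e"
        using d q dist_triangle[of x y d] by simp
    qed
    then show ?thesis using d q e by (intro bexI[of _ "(d, q)"]) (auto simp: dist_commute)
  qed
  then have "U = (\<Union>i\<in>?I. cball (fst i) (snd i))" by fastforce
  moreover have "countable ?I"
    by (rule countable_subset[of _ "D \<times> \<rat>"]) (use D(1) countable_rat in auto)
  moreover have "(\<Union>i\<in>?I. cball (fst i) (snd i)) \<in> sigma_sets UNIV \<H>"
    using \<open>countable ?I\<close> cball by (intro sigma_sets_UNION) auto
  ultimately show ?thesis by simp
qed

theorem char_functional_determines_measure:
  fixes P Q :: "'a::{real_inner, second_countable_topology} measure"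
  assumes P: "P \<in> borel_prob_measures" and Q: "Q \<in> borel_prob_measures"
    and eq: "char_functional P = char_functional Q"
  shows "P = Q"
proof -
  interpret P: prob_space P using P by (rule borel_prob_measuresD)
  interpret Q: prob_space Q using Q by (rule borel_prob_measuresD)
  \<comment> \<open>The family \<open>\<C>\<close> need not be closed under intersections. The family \<open>\<D>\<close> of sets that preserve
    \<open>\<C>\<close> is closed under them, contains the half-spaces, and is contained in \<open>\<C>\<close> because \<open>UNIV \<in> \<C>\<close>.\<close>
  define \<C> where "\<C> = {A \<in> sets borel. fourier_on P A = fourier_on Q A}"
  define \<D> where "\<D> = {S \<in> sets borel. \<forall>A\<in>\<C>. A \<inter> S \<in> \<C>}"
  have UNIV: "UNIV \<in> \<C>" "UNIV \<in> \<D>"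
    using eq by (auto simp: \<C>_def \<D>_def fourier_on_def char_functional_def fun_eq_iff)
  have half: "{z. u \<bullet> z \<le> b} \<in> \<D>" for u b
    using fourier_on_slice[OF P Q, of _ "{..b}" u] by (auto simp: \<D>_def \<C>_def)
  have gen: "sigma_sets UNIV \<D> = sets borel"
  proof
    show "sigma_sets UNIV \<D> \<subseteq> sets borel"
      using sets.sigma_sets_subset[of \<D> borel] by (auto simp: \<D>_def)
    show "sets borel \<subseteq> sigma_sets UNIV \<D>"
      unfolding borel_def using open_in_sigma_halfspaces[OF _ half]
      by (auto intro!: sigma_sets_mono)
  qed
  show ?thesis
  proof (rule measure_eqI_generator_eq[where E=\<D> and \<Omega>=UNIV and A="\<lambda>_::nat. UNIV"])
    show "Int_stable \<D>"
      by (auto simp: Int_stable_def \<D>_def Int_assoc[symmetric])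
    fix S assume "S \<in> \<D>"
    then have S: "S \<in> sets borel" "fourier_on P S = fourier_on Q S"
      using UNIV by (auto simp: \<D>_def \<C>_def)
    from fun_cong[OF S(2), of 0] S(1) show "emeasure P S = emeasure Q S"
      by (simp add: fourier_on_def borel_prob_measuresD[OF P] borel_prob_measuresD[OF Q]
          P.emeasure_eq_measure Q.emeasure_eq_measure scaleR_conv_of_real)
  qed (use UNIV in \<open>simp_all add: gen borel_prob_measuresD[OF P] borel_prob_measuresD[OF Q]\<close>)
qed

section \<open>Separation of points by the energy distance\<close>

lemma norm_char_functional_le_1:
  assumes "P \<in> borel_prob_measures"
  shows "cmod (char_functional P w) \<le> 1"
proof -
  interpret prob_space P using assms by (rule borel_prob_measuresD)
  show ?thesis
    unfolding char_functional_def
    using integral_norm_bound[of P "\<lambda>z. iexp (w \<bullet> z)"] by (simp add: prob_space)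
qed

lemma continuous_char_functional:
  fixes P :: "'a::{real_inner, second_countable_topology} measure"
  assumes P: "P \<in> borel_prob_measures"
  shows "continuous_on UNIV (char_functional P)"
  unfolding continuous_on_sequentially comp_def
proof (intro ballI allI impI, elim conjE)
  interpret prob_space P using P by (rule borel_prob_measuresD)
  fix x :: "nat \<Rightarrow> 'a" and w assume "x \<longlonglongrightarrow> w"
  then show "(\<lambda>n. char_functional P (x n)) \<longlonglongrightarrow> char_functional P w"
    unfolding char_functional_def
  proof (intro integral_dominated_convergence[where w="\<lambda>_. 1"] AE_I2)
    show "(\<lambda>n. iexp (x n \<bullet> z)) \<longlonglongrightarrow> iexp (w \<bullet> z)" for z
      using \<open>x \<longlonglongrightarrow> w\<close> by (intro tendsto_intros)
  qed (auto intro!: measurable_borel_prob_measures[OF P])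
qed

lemma continuous_AE_zero_imp_zero:
  fixes f :: "'a::topological_space \<Rightarrow> 'b::real_normed_vector"
  assumes M: "sets M = sets borel" and supp: "measure_support M = UNIV"
    and cont: "continuous_on UNIV f" and AE: "AE x in M. f x = 0"
  shows "f x = 0"
proof (rule ccontr)
  assume "f x \<noteq> 0"
  have op: "open {y. f y \<noteq> 0}"
    by (intro open_Collect_neq cont continuous_on_const)
  then have "emeasure M {y. f y \<noteq> 0} = 0"
    using AE sets_eq_imp_space_eq[OF M] by (subst (asm) AE_iff_measurable) (auto simp: M)
  moreover have "x \<in> measure_support M" by (simp add: supp)
  then have "emeasure M {y. f y \<noteq> 0} > 0"
    using op \<open>f x \<noteq> 0\<close> by (auto simp: measure_support_def)
  ultimately show False by simp
qed

theorem corollary2p5: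
  fixes \<nu> :: "'h::{real_inner, complete_space, second_countable_topology} measure"
  assumes infinite_dimensional: "\<not> (\<exists>B :: 'h set. finite B \<and> span B = UNIV)"
    and reference: "reference_measure \<nu>"
  shows "Metric_space (borel_prob_measures :: 'h measure set) (energy_dist \<nu>)"
proof
  have \<nu>: "\<nu> \<in> borel_prob_measures" "measure_support \<nu> = UNIV"
    using reference by (auto simp: reference_measure_def)
  define \<delta> where "\<delta> P Q w = cmod (char_functional P w - char_functional Q w)"
    for P Q and w :: 'h
  have ed: "energy_dist \<nu> P Q = sqrt (LINT w|\<nu>. (\<delta> P Q w)\<^sup>2)" for P Q
    by (simp add: energy_dist_def \<delta>_def)
  have cont: "continuous_on UNIV (\<lambda>w. (\<delta> P Q w)\<^sup>2)"
    if "P \<in> borel_prob_measures" "Q \<in> borel_prob_measures" for P Q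
    unfolding \<delta>_def using that by (intro continuous_intros continuous_char_functional)
  have int: "integrable \<nu> (\<lambda>w. (\<delta> P Q w)\<^sup>2)"
    if P: "P \<in> borel_prob_measures" and Q: "Q \<in> borel_prob_measures" for P Q
  proof (rule integrable_borel_prob_measures[OF \<nu>(1) borel_measurable_continuous_onI[OF cont[OF P Q]]])
    fix w
    have "\<delta> P Q w \<le> 2"
      unfolding \<delta>_def using norm_triangle_ineq4[of "char_functional P w" "char_functional Q w"]
        norm_char_functional_le_1[OF P, of w] norm_char_functional_le_1[OF Q, of w] by linarith
    then have "(\<delta> P Q w)\<^sup>2 \<le> 2\<^sup>2" by (intro power_mono) (simp_all add: \<delta>_def)
    then show "norm ((\<delta> P Q w)\<^sup>2) \<le> 4" by simp
  qed
  show "0 \<le> energy_dist \<nu> P Q" for P Q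
    by (simp add: energy_dist_def)
  show "energy_dist \<nu> P Q = energy_dist \<nu> Q P" for P Q
    by (simp add: energy_dist_def norm_minus_commute)
  show "energy_dist \<nu> P Q = 0 \<longleftrightarrow> P = Q"
    if P: "P \<in> borel_prob_measures" and Q: "Q \<in> borel_prob_measures" for P Q
  proof
    assume "energy_dist \<nu> P Q = 0"
    then have "AE w in \<nu>. (\<delta> P Q w)\<^sup>2 = 0"
      using integral_nonneg_eq_0_iff_AE[OF int[OF P Q]] by (simp add: ed)
    then have "(\<delta> P Q w)\<^sup>2 = 0" for w
      by (rule continuous_AE_zero_imp_zero[OF borel_prob_measuresD(2)[OF \<nu>(1)] \<nu>(2) cont[OF P Q]])
    then have "char_functional P = char_functional Q"
      by (auto simp: \<delta>_def)
    then show "P = Q"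
      by (rule char_functional_determines_measure[OF P Q])
  qed (simp add: energy_dist_def)
  show "energy_dist \<nu> P R \<le> energy_dist \<nu> P Q + energy_dist \<nu> Q R"
    if "P \<in> borel_prob_measures" "Q \<in> borel_prob_measures" "R \<in> borel_prob_measures" for P Q R
    unfolding ed
  proof (rule sqrt_integral_power2_triangle)
    show "\<bar>\<delta> P R w\<bar> \<le> \<bar>\<delta> P Q w\<bar> + \<bar>\<delta> Q R w\<bar>" for w
      using norm_triangle_ineq[of "char_functional P w - char_functional Q w"
          "char_functional Q w - char_functional R w"] by (simp add: \<delta>_def)
  qed (use that int in auto)
qed

end
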